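(* Let $G=(V,E)$ be an infinite, connected, locally finite graph. If the vertex weight $\omega:V\to\mathbb{R}_+^\star$ is constant on $V$, then for any conductance $c:E\to\mathbb{R}_+^\star$, the Laplacian $\Delta_{\omega,c}$, with domain $C_0(V)$, is essentially self-adjoint (as an operator on $l^2_\omega(V)$).
   Context: $G=(V,E)$ is a graph with vertex set $V$ and edge set $E$, whose edges are unordered pairs $\{x,y\}$ of distinct vertices; $x\sim y$ means $\{x,y\}\in E$. $\mathbb{R}_+^\star=(0,\infty)$. A function $c$ on $E$ is written $c_{x,y}=c_{y,x}$ for $\{x,y\}\in E$. $C_0(V)$ is the space of finitely supported functions $V\to\mathbb{R}$. For $\omega:V\to\mathbb{R}_+^\star$, $l^2_\omega(V)=\{f:V\to\mathbb{R}:\sum_{x\in V}\omega_x^2|f(x)|^2<\infty\}$ is a Hilbert space with scalar product $\langle f,g\rangle_{l^2_\omega}=\sum_{x\in V}\omega_x^2f(x)g(x)$. The weighted graph Laplacian with vertex weight $\omega$ and edge conductance $c$ is $$(\Delta_{\omega,c}f)(x)=\frac{1}{\omega_x^2}\sum_{y\sim x}c_{x,y}(f(x)-f(y)).$$ An unbounded symmetric linear operator on a Hilbert space is essentially self-adjoint if it has a unique self-adjoint extension. *)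

theory Defs
  imports "HOL-Analysis.Analysis"
begin

section \<open>Graphs\<close>

definition simple_graph :: "'v set \<Rightarrow> 'v set set \<Rightarrow> bool" where
  "simple_graph V E \<longleftrightarrow> (\<forall>e\<in>E. \<exists>x\<in>V. \<exists>y\<in>V. x \<noteq> y \<and> e = {x, y})"

definition neighbours :: "'v set set \<Rightarrow> 'v \<Rightarrow> 'v set" where
  "neighbours E x = {y. {x, y} \<in> E}"

definition connected_graph :: "'v set \<Rightarrow> 'v set set \<Rightarrow> bool" where
  "connected_graph V E \<longleftrightarrow> (\<forall>x\<in>V. \<forall>y\<in>V. (x, y) \<in> {(a, b). {a, b} \<in> E}\<^sup>*)"

definition locally_finite_graph :: "'v set \<Rightarrow> 'v set set \<Rightarrow> bool" where
  "locally_finite_graph V E \<longleftrightarrow> (\<forall>x\<in>V. finite (neighbours E x))"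


section \<open>The function spaces\<close>

text \<open>A function from \<open>V\<close> to the reals is encoded as a function on the whole type that
  vanishes outside \<open>V\<close>, so that equality of such functions is equality on \<open>V\<close>.\<close>

definition fin_supp :: "'v set \<Rightarrow> ('v \<Rightarrow> real) set" where
  "fin_supp V = {f. (\<forall>x. x \<notin> V \<longrightarrow> f x = 0) \<and> finite {x. f x \<noteq> 0}}"

definition l2 :: "'v set \<Rightarrow> ('v \<Rightarrow> real) \<Rightarrow> ('v \<Rightarrow> real) set" where
  "l2 V \<omega> = {f. (\<forall>x. x \<notin> V \<longrightarrow> f x = 0) \<and> (\<lambda>x. (\<omega> x)\<^sup>2 * \<bar>f x\<bar>\<^sup>2) summable_on V}"

definition l2_inner :: "'v set \<Rightarrow> ('v \<Rightarrow> real) \<Rightarrow> ('v \<Rightarrow> real) \<Rightarrow> ('v \<Rightarrow> real) \<Rightarrow> real" where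
  "l2_inner V \<omega> f g = (\<Sum>\<^sub>\<infinity>x\<in>V. (\<omega> x)\<^sup>2 * f x * g x)"

definition l2_norm :: "'v set \<Rightarrow> ('v \<Rightarrow> real) \<Rightarrow> ('v \<Rightarrow> real) \<Rightarrow> real" where
  "l2_norm V \<omega> f = sqrt (l2_inner V \<omega> f f)"


section \<open>Unbounded operators\<close>

text \<open>An unbounded operator is a partial map: \<open>dom T\<close> is its domain, equality of partial
  maps is equality of operators including their domains, and \<open>T \<subseteq>\<^sub>m S\<close> says that \<open>S\<close>
  extends \<open>T\<close>.\<close>

type_synonym 'v operator = "('v \<Rightarrow> real) \<rightharpoonup> ('v \<Rightarrow> real)"

definition linear_operator :: "'v set \<Rightarrow> ('v \<Rightarrow> real) \<Rightarrow> 'v operator \<Rightarrow> bool" where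
  "linear_operator V \<omega> T \<longleftrightarrow>
     dom T \<subseteq> l2 V \<omega> \<and> ran T \<subseteq> l2 V \<omega> \<and> dom T \<noteq> {} \<and>
     (\<forall>f\<in>dom T. \<forall>g\<in>dom T. \<forall>a b.
        T (\<lambda>x. a * f x + b * g x) = Some (\<lambda>x. a * the (T f) x + b * the (T g) x))"

definition densely_defined :: "'v set \<Rightarrow> ('v \<Rightarrow> real) \<Rightarrow> 'v operator \<Rightarrow> bool" where
  "densely_defined V \<omega> T \<longleftrightarrow>
     (\<forall>f\<in>l2 V \<omega>. \<forall>\<epsilon>>0. \<exists>g\<in>dom T. l2_norm V \<omega> (\<lambda>x. f x - g x) < \<epsilon>)"

definition symmetric_operator :: "'v set \<Rightarrow> ('v \<Rightarrow> real) \<Rightarrow> 'v operator \<Rightarrow> bool" where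
  "symmetric_operator V \<omega> T \<longleftrightarrow>
     linear_operator V \<omega> T \<and> densely_defined V \<omega> T \<and>
     (\<forall>f\<in>dom T. \<forall>g\<in>dom T. l2_inner V \<omega> (the (T f)) g = l2_inner V \<omega> f (the (T g)))"

text \<open>The description below determines the value of the adjoint uniquely only if \<open>T\<close> is
  densely defined; the adjoint is used for such \<open>T\<close> only.\<close>

definition is_adjoint_value ::
    "'v set \<Rightarrow> ('v \<Rightarrow> real) \<Rightarrow> 'v operator \<Rightarrow> ('v \<Rightarrow> real) \<Rightarrow> ('v \<Rightarrow> real) \<Rightarrow> bool" where
  "is_adjoint_value V \<omega> T g h \<longleftrightarrow>
     g \<in> l2 V \<omega> \<and> h \<in> l2 V \<omega> \<and>
     (\<forall>f\<in>dom T. l2_inner V \<omega> (the (T f)) g = l2_inner V \<omega> f h)"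

definition adjoint_operator :: "'v set \<Rightarrow> ('v \<Rightarrow> real) \<Rightarrow> 'v operator \<Rightarrow> 'v operator" where
  "adjoint_operator V \<omega> T =
     (\<lambda>g. if \<exists>h. is_adjoint_value V \<omega> T g h then Some (THE h. is_adjoint_value V \<omega> T g h)
          else None)"

definition self_adjoint :: "'v set \<Rightarrow> ('v \<Rightarrow> real) \<Rightarrow> 'v operator \<Rightarrow> bool" where
  "self_adjoint V \<omega> T \<longleftrightarrow>
     linear_operator V \<omega> T \<and> densely_defined V \<omega> T \<and> adjoint_operator V \<omega> T = T"

definition essentially_self_adjoint :: "'v set \<Rightarrow> ('v \<Rightarrow> real) \<Rightarrow> 'v operator \<Rightarrow> bool" where
  "essentially_self_adjoint V \<omega> T \<longleftrightarrow>
     symmetric_operator V \<omega> T \<and> (\<exists>!S. self_adjoint V \<omega> S \<and> T \<subseteq>\<^sub>m S)"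


section \<open>The weighted Laplacian\<close>

text \<open>The conductance \<open>c\<close> is a function on edges, so \<open>c\<^bsub>x,y\<^esub> = c\<^bsub>y,x\<^esub>\<close> is \<open>c {x, y}\<close>.
  Outside the vertex set there are no neighbours, so there the value is 0.\<close>

definition laplacian ::
    "'v set set \<Rightarrow> ('v \<Rightarrow> real) \<Rightarrow> ('v set \<Rightarrow> real) \<Rightarrow> ('v \<Rightarrow> real) \<Rightarrow> 'v \<Rightarrow> real" where
  "laplacian E \<omega> c f x = 1 / (\<omega> x)\<^sup>2 * (\<Sum>y\<in>neighbours E x. c {x, y} * (f x - f y))"

definition laplacian_operator ::
    "'v set \<Rightarrow> 'v set set \<Rightarrow> ('v \<Rightarrow> real) \<Rightarrow> ('v set \<Rightarrow> real) \<Rightarrow> 'v operator" where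
  "laplacian_operator V E \<omega> c = (Some \<circ> laplacian E \<omega> c) |` fin_supp V"

end

theory Submission
  imports Defs
begin

text \<open>On functions of \<open>l\<^sup>2\<close>, the equation \<open>\<Delta> g + g = 0\<close> has only the trivial solution: as the weight
  is bounded below, a positive value of \<open>g\<close> would force a positive global maximum, where
  \<open>\<Delta> g \<ge> 0\<close>. On the other hand, \<open>\<Delta> h + h = u\<close> is solved by the sum over walks (Neumann series)
  starting from \<open>u\<close>; this solution operator \<open>R\<close> has a nonnegative symmetric kernel and \<open>R 1 \<le> 1\<close>,
  whence it is a symmetric contraction of \<open>l\<^sup>2\<close>. So every \<open>g\<close> in the maximal domain equals
  \<open>R (\<Delta> g + g)\<close>, the maximal Laplacian is symmetric, and being the adjoint of the Laplacian on
  \<open>C\<^sub>0(V)\<close> it is the only self-adjoint extension.\<close>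

section \<open>Weighted square-summable functions\<close>

lemma l2_mult_summable:
  assumes "f \<in> l2 V \<omega>" "g \<in> l2 V \<omega>"
  shows "(\<lambda>x. (\<omega> x)\<^sup>2 * f x * g x) summable_on V"
proof -
  have "(\<lambda>x. (\<omega> x)\<^sup>2 * \<bar>f x\<bar>\<^sup>2 + (\<omega> x)\<^sup>2 * \<bar>g x\<bar>\<^sup>2) summable_on V"
    using assms by (intro summable_on_add) (auto simp: l2_def)
  moreover have "norm ((\<omega> x)\<^sup>2 * f x * g x) \<le> (\<omega> x)\<^sup>2 * \<bar>f x\<bar>\<^sup>2 + (\<omega> x)\<^sup>2 * \<bar>g x\<bar>\<^sup>2" for x
  proof -
    have "0 \<le> (\<bar>f x\<bar> - \<bar>g x\<bar>)\<^sup>2" by simp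
    then have "2 * (\<bar>f x\<bar> * \<bar>g x\<bar>) \<le> \<bar>f x\<bar>\<^sup>2 + \<bar>g x\<bar>\<^sup>2"
      by (simp add: power2_diff)
    moreover have "0 \<le> \<bar>f x\<bar> * \<bar>g x\<bar>" by simp
    ultimately have "\<bar>f x\<bar> * \<bar>g x\<bar> \<le> \<bar>f x\<bar>\<^sup>2 + \<bar>g x\<bar>\<^sup>2" by linarith
    from mult_left_mono[OF this, of "(\<omega> x)\<^sup>2"] show ?thesis
      by (simp add: abs_mult algebra_simps)
  qed
  ultimately have "(\<lambda>x. norm ((\<omega> x)\<^sup>2 * f x * g x)) summable_on V"
    by (rule Infinite_Sum.abs_summable_on_comparison_test')
  then show ?thesis by (rule abs_summable_summable)
qed

lemma l2_lincomb:
  assumes "f \<in> l2 V \<omega>" "g \<in> l2 V \<omega>"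
  shows "(\<lambda>x. a * f x + b * g x) \<in> l2 V \<omega>"
proof -
  have "(\<lambda>x. a\<^sup>2 * ((\<omega> x)\<^sup>2 * f x * f x) + ((2 * a * b) * ((\<omega> x)\<^sup>2 * f x * g x)
          + b\<^sup>2 * ((\<omega> x)\<^sup>2 * g x * g x))) summable_on V"
    by (intro summable_on_add summable_on_cmult_right l2_mult_summable assms)
  then have "(\<lambda>x. (\<omega> x)\<^sup>2 * \<bar>a * f x + b * g x\<bar>\<^sup>2) summable_on V"
    by (rule back_subst[of "\<lambda>f. f summable_on V"])
      (auto simp: power2_eq_square algebra_simps)
  then show ?thesis using assms by (auto simp: l2_def)
qed

lemma l2_inner_commute: "l2_inner V \<omega> f g = l2_inner V \<omega> g f"
  by (simp add: l2_inner_def mult_ac)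

lemma l2_inner_lincomb_left:
  assumes "f \<in> l2 V \<omega>" "g \<in> l2 V \<omega>" "h \<in> l2 V \<omega>"
  shows "l2_inner V \<omega> (\<lambda>x. a * f x + b * g x) h = a * l2_inner V \<omega> f h + b * l2_inner V \<omega> g h"
proof -
  have "l2_inner V \<omega> (\<lambda>x. a * f x + b * g x) h
      = (\<Sum>\<^sub>\<infinity>x\<in>V. a * ((\<omega> x)\<^sup>2 * f x * h x) + b * ((\<omega> x)\<^sup>2 * g x * h x))"
    unfolding l2_inner_def by (simp add: algebra_simps)
  also have "\<dots> = (\<Sum>\<^sub>\<infinity>x\<in>V. a * ((\<omega> x)\<^sup>2 * f x * h x)) + (\<Sum>\<^sub>\<infinity>x\<in>V. b * ((\<omega> x)\<^sup>2 * g x * h x))"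
    by (intro infsum_add summable_on_cmult_right l2_mult_summable assms)
  also have "\<dots> = a * l2_inner V \<omega> f h + b * l2_inner V \<omega> g h"
    unfolding l2_inner_def by (simp add: infsum_cmult_right l2_mult_summable assms)
  finally show ?thesis .
qed

lemma l2_inner_lincomb_right:
  assumes "f \<in> l2 V \<omega>" "g \<in> l2 V \<omega>" "h \<in> l2 V \<omega>"
  shows "l2_inner V \<omega> h (\<lambda>x. a * f x + b * g x) = a * l2_inner V \<omega> h f + b * l2_inner V \<omega> h g"
  using l2_inner_lincomb_left[OF assms] by (simp add: l2_inner_commute)

text \<open>Bridge to extended nonnegative integrals: the resolvent is estimated in
  \<open>ennreal\<close>, where sums need no convergence proof, and membership in \<open>l2\<close>
  is then read off from a finite integral. Integrating over the whole type is harmless because the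
  functions vanish off \<open>V\<close>.\<close>

lemma l2_iff_nn_integral:
  "f \<in> l2 V \<omega> \<longleftrightarrow> (\<forall>x. x \<notin> V \<longrightarrow> f x = 0) \<and>
     (\<integral>\<^sup>+x. ennreal ((\<omega> x)\<^sup>2 * (f x)\<^sup>2) \<partial>count_space UNIV) < \<infinity>"
proof (cases "\<forall>x. x \<notin> V \<longrightarrow> f x = 0")
  case True
  have eq: "(\<integral>\<^sup>+x. ennreal ((\<omega> x)\<^sup>2 * (f x)\<^sup>2) \<partial>count_space UNIV)
          = (\<integral>\<^sup>+x. ennreal ((\<omega> x)\<^sup>2 * (f x)\<^sup>2) \<partial>count_space V)"
    using True by (intro nn_integral_count_space_eq) auto
  have "f \<in> l2 V \<omega> \<longleftrightarrow> (\<lambda>x. norm ((\<omega> x)\<^sup>2 * (f x)\<^sup>2)) summable_on V"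
    using True by (simp add: l2_def)
  also have "\<dots> \<longleftrightarrow> integrable (count_space V) (\<lambda>x. (\<omega> x)\<^sup>2 * (f x)\<^sup>2)"
    unfolding abs_summable_equivalent abs_summable_on_def ..
  also have "\<dots> \<longleftrightarrow> (\<integral>\<^sup>+x. ennreal ((\<omega> x)\<^sup>2 * (f x)\<^sup>2) \<partial>count_space V) < \<infinity>"
    by (simp add: integrable_iff_bounded)
  finally show ?thesis using True eq by simp
qed (auto simp: l2_def)

lemma l2_inner_eq_nn_integral:
  assumes "f \<in> l2 V \<omega>" "g \<in> l2 V \<omega>" "\<And>x. f x \<ge> 0" "\<And>x. g x \<ge> 0"
  shows "ennreal (l2_inner V \<omega> f g) = (\<integral>\<^sup>+x. ennreal ((\<omega> x)\<^sup>2 * f x * g x) \<partial>count_space UNIV)"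
proof -
  have "(\<lambda>x. norm ((\<omega> x)\<^sup>2 * f x * g x)) summable_on V"
    using l2_mult_summable[OF assms(1,2)] assms(3,4) by (simp add: abs_mult)
  then have s: "Infinite_Set_Sum.abs_summable_on (\<lambda>x. (\<omega> x)\<^sup>2 * f x * g x) V"
    by (simp only: abs_summable_equivalent)
  have "(\<integral>\<^sup>+x. ennreal ((\<omega> x)\<^sup>2 * f x * g x) \<partial>count_space UNIV)
      = (\<integral>\<^sup>+x. ennreal ((\<omega> x)\<^sup>2 * f x * g x) \<partial>count_space V)"
    using assms(1) by (intro nn_integral_count_space_eq) (auto simp: l2_def)
  also have "\<dots> = ennreal (l2_inner V \<omega> f g)"
    unfolding l2_inner_def infsetsum_infsum[OF s, symmetric]
    by (rule nn_integral_conv_infsetsum[OF s]) (simp add: assms)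
  finally show ?thesis by simp
qed

lemma fin_supp_subset_l2: "fin_supp V \<subseteq> l2 V \<omega>"
proof
  fix f :: "'a \<Rightarrow> real" assume f: "f \<in> fin_supp V"
  then have "finite {x \<in> V. (\<omega> x)\<^sup>2 * \<bar>f x\<bar>\<^sup>2 \<noteq> 0}"
    by (auto simp: fin_supp_def elim!: finite_subset[rotated])
  then have "(\<lambda>x. (\<omega> x)\<^sup>2 * \<bar>f x\<bar>\<^sup>2) summable_on V"
    by (rule finite_nonzero_values_imp_summable_on)
  with f show "f \<in> l2 V \<omega>" by (simp add: fin_supp_def l2_def)
qed

lemma l2_inner_eq_sum:
  assumes "finite F" "F \<subseteq> V" "\<And>x. x \<notin> F \<Longrightarrow> f x * g x = 0"
  shows "l2_inner V \<omega> f g = (\<Sum>x\<in>F. (\<omega> x)\<^sup>2 * f x * g x)"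
proof -
  have "l2_inner V \<omega> f g = (\<Sum>\<^sub>\<infinity>x\<in>F. (\<omega> x)\<^sup>2 * f x * g x)"
    unfolding l2_inner_def using assms by (intro infsum_cong_neutral) auto
  then show ?thesis using assms(1) by simp
qed

lemma fin_supp_dense:
  assumes f: "f \<in> l2 V \<omega>" and e: "e > 0"
  shows "\<exists>g\<in>fin_supp V. l2_norm V \<omega> (\<lambda>x. f x - g x) < e"
proof -
  let ?q = "\<lambda>x. (\<omega> x)\<^sup>2 * f x * f x"
  have s: "?q summable_on V" by (rule l2_mult_summable[OF f f])
  \<comment> \<open>Half of \<open>e\<^sup>2\<close>, because the finite approximation gives only
    \<open>\<le>\<close>, whereas the norm must be strictly below \<open>e\<close>.\<close>
  have "0 < e\<^sup>2 / 2" using e by simp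
  from infsum_finite_approximation[OF s this] obtain F where
    F: "finite F" "F \<subseteq> V" "dist (sum ?q F) (infsum ?q V) \<le> e\<^sup>2 / 2" by auto
  let ?g = "\<lambda>x. if x \<in> F then f x else 0"
  have "infsum ?q V = infsum ?q (F \<union> (V - F))"
    using F(2) by (simp add: Un_absorb1)
  also have "\<dots> = sum ?q F + infsum ?q (V - F)"
    using F s by (subst infsum_Un_disjoint) (auto intro: summable_on_subset)
  finally have "infsum ?q (V - F) \<le> e\<^sup>2 / 2"
    using F(3) by (simp add: dist_real_def)
  moreover have "l2_inner V \<omega> (\<lambda>x. f x - ?g x) (\<lambda>x. f x - ?g x) = infsum ?q (V - F)"
    unfolding l2_inner_def using F by (intro infsum_cong_neutral) auto
  ultimately have "l2_inner V \<omega> (\<lambda>x. f x - ?g x) (\<lambda>x. f x - ?g x) < e\<^sup>2"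
    using \<open>0 < e\<^sup>2 / 2\<close> by linarith
  then have "l2_norm V \<omega> (\<lambda>x. f x - ?g x) < e"
    unfolding l2_norm_def using e by (intro real_less_lsqrt) auto
  moreover have "?g \<in> fin_supp V"
    using F by (auto simp: fin_supp_def)
  ultimately show ?thesis by (intro bexI[of _ ?g])
qed

text \<open>Each point of an infinite superlevel set would contribute at least
  \<open>s\<^sup>2 * e\<^sup>2\<close> to the square norm. This is where a weight bounded away from
  0 enters the argument.\<close>

lemma l2_finite_superlevel:
  assumes f: "f \<in> l2 V \<omega>" and "e > 0" and "s > 0" and s: "\<And>x. x \<in> V \<Longrightarrow> s \<le> \<omega> x"
  shows "finite {x. f x \<ge> e}"
proof (rule ccontr)
  assume inf: "infinite {x. f x \<ge> e}"
  let ?S = "{x. f x \<ge> e}"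
  have "\<infinity> = (\<integral>\<^sup>+x. ennreal (s\<^sup>2 * e\<^sup>2) \<partial>count_space ?S)"
    using inf \<open>e > 0\<close> \<open>s > 0\<close> by (simp add: ennreal_mult_top)
  also have "\<dots> \<le> (\<integral>\<^sup>+x. ennreal ((\<omega> x)\<^sup>2 * (f x)\<^sup>2) \<partial>count_space ?S)"
  proof (intro nn_integral_mono ennreal_leI mult_mono power_mono)
    fix x assume "x \<in> space (count_space ?S)"
    then have x: "e \<le> f x" by simp
    then have "x \<in> V" using f \<open>e > 0\<close> by (force simp: l2_def)
    then show "s \<le> \<omega> x" by (rule s)
    show "e \<le> f x" by (rule x)
  qed (use \<open>e > 0\<close> \<open>s > 0\<close> in auto)
  also have "\<dots> \<le> (\<integral>\<^sup>+x. ennreal ((\<omega> x)\<^sup>2 * (f x)\<^sup>2) \<partial>count_space UNIV)"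
    by (auto simp: nn_integral_count_space_indicator intro!: nn_integral_mono split: split_indicator)
  also have "\<dots> < \<infinity>" using f by (simp add: l2_iff_nn_integral)
  finally show False by simp
qed

section \<open>The Laplacian\<close>

locale weighted_graph =
  fixes V :: "'v set" and E :: "'v set set" and \<omega> :: "'v \<Rightarrow> real" and c :: "'v set \<Rightarrow> real"
  assumes graph: "simple_graph V E"
    and loc_fin: "locally_finite_graph V E"
    and weight_pos: "x \<in> V \<Longrightarrow> \<omega> x > 0"
    and cond_pos: "e \<in> E \<Longrightarrow> c e > 0"
begin

lemma neighboursD: "y \<in> neighbours E x \<Longrightarrow> x \<in> V \<and> y \<in> V \<and> x \<in> neighbours E y"
  using graph by (auto simp: neighbours_def simple_graph_def insert_commute doubleton_eq_iff)

lemma neighbours_outside: "x \<notin> V \<Longrightarrow> neighbours E x = {}"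
  using neighboursD by blast

lemma finite_neighbours: "finite (neighbours E x)"
  using loc_fin neighbours_outside[of x] by (cases "x \<in> V") (auto simp: locally_finite_graph_def)

lemma cond_neighbour_pos: "y \<in> neighbours E x \<Longrightarrow> c {x, y} > 0"
  by (simp add: neighbours_def cond_pos)

lemma laplacian_outside: "x \<notin> V \<Longrightarrow> laplacian E \<omega> c f x = 0"
  by (simp add: laplacian_def neighbours_outside)

lemma weight_laplacian:
  "(\<omega> x)\<^sup>2 * laplacian E \<omega> c f x = (\<Sum>y\<in>neighbours E x. c {x, y} * (f x - f y))"
  using weight_pos[of x] by (cases "x \<in> V") (auto simp: laplacian_def neighbours_outside)

lemma laplacian_lincomb:
  "laplacian E \<omega> c (\<lambda>x. a * f x + b * g x) =
     (\<lambda>x. a * laplacian E \<omega> c f x + b * laplacian E \<omega> c g x)"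
  unfolding laplacian_def
  by (simp add: fun_eq_iff sum_distrib_left flip: sum.distrib)
    (simp add: algebra_simps add_divide_distrib diff_divide_distrib)

lemma laplacian_fin_supp:
  assumes "f \<in> fin_supp V"
  shows "laplacian E \<omega> c f \<in> fin_supp V"
proof -
  have "{x. laplacian E \<omega> c f x \<noteq> 0} \<subseteq> (\<Union>y\<in>{y. f y \<noteq> 0}. insert y (neighbours E y))"
  proof
    fix x assume "x \<in> {x. laplacian E \<omega> c f x \<noteq> 0}"
    then have "(\<Sum>y\<in>neighbours E x. c {x, y} * (f x - f y)) \<noteq> 0"
      by (auto simp: laplacian_def)
    then obtain y where "y \<in> neighbours E x" "f x - f y \<noteq> 0"
      by (metis (no_types, lifting) mult_zero_right sum.neutral)
    then show "x \<in> (\<Union>y\<in>{y. f y \<noteq> 0}. insert y (neighbours E y))"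
      using neighboursD by (cases "f x = 0") auto
  qed
  moreover have "finite (\<Union>y\<in>{y. f y \<noteq> 0}. insert y (neighbours E y))"
    using assms finite_neighbours by (auto simp: fin_supp_def)
  ultimately show ?thesis
    using laplacian_outside by (auto simp: fin_supp_def intro: finite_subset)
qed

text \<open>The terms in \<open>f x * g x\<close> agree on both sides, and the mixed terms form a
  finite double sum with a symmetric kernel. As \<open>g\<close> is arbitrary, the formula can be
  applied before \<open>\<Delta> g\<close> is known to lie in \<open>l\<^sup>2\<close>.\<close>

lemma green:
  assumes f: "f \<in> fin_supp V"
  shows "l2_inner V \<omega> (laplacian E \<omega> c f) g = l2_inner V \<omega> f (laplacian E \<omega> c g)"
proof -
  \<comment> \<open>\<open>F\<close> contains the supports of \<open>f\<close> and of
    \<open>\<Delta> f\<close>, so both inner products become finite sums over it.\<close>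
  define F where "F = (\<Union>y\<in>{y. f y \<noteq> 0}. insert y (neighbours E y))"
  define b where "b x y = (if y \<in> neighbours E x then c {x, y} else 0)" for x y
  have b_sym: "b x y = b y x" for x y
    using neighboursD by (auto simp: b_def insert_commute)
  have finF: "finite F" using f finite_neighbours by (auto simp: fin_supp_def F_def)
  have FV: "F \<subseteq> V"
    using f neighboursD by (fastforce simp: F_def fin_supp_def)
  have supp: "f x = 0" if "x \<notin> F" for x using that by (auto simp: F_def)
  have nbF: "y \<in> F" if "f x \<noteq> 0" "y \<in> neighbours E x" for x y using that by (auto simp: F_def)
  have lap0: "laplacian E \<omega> c f x = 0" if "x \<notin> F" for x
  proof -
    have "f y = 0" if "y \<in> neighbours E x" for y
      using that \<open>x \<notin> F\<close> neighboursD nbF by blast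
    then show ?thesis using supp[OF that] by (simp add: laplacian_def)
  qed
  have 1: "(\<Sum>y\<in>neighbours E x. c {x, y} * (f x * g y)) = (\<Sum>y\<in>F. b x y * (f x * g y))" for x
  proof (cases "f x = 0")
    case False
    then show ?thesis using nbF[OF False] finF
      by (intro sum.mono_neutral_cong_left) (auto simp: b_def)
  qed simp
  have 2: "(\<Sum>y\<in>neighbours E x. c {x, y} * (g x * f y)) = (\<Sum>y\<in>F. b x y * (g x * f y))" for x
    using supp finF finite_neighbours by (intro sum.mono_neutral_cong) (auto simp: b_def)
  have "l2_inner V \<omega> (laplacian E \<omega> c f) g = (\<Sum>x\<in>F. (\<omega> x)\<^sup>2 * laplacian E \<omega> c f x * g x)"
    using finF FV lap0 by (intro l2_inner_eq_sum) auto
  also have "\<dots> = (\<Sum>x\<in>F. (\<Sum>y\<in>neighbours E x. c {x, y} * (f x * g x))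
                        - (\<Sum>y\<in>F. b x y * (g x * f y)))"
    unfolding weight_laplacian 2[symmetric]
    by (simp add: sum_distrib_right flip: sum_subtractf) (simp add: algebra_simps)
  also have "\<dots> = (\<Sum>x\<in>F. \<Sum>y\<in>neighbours E x. c {x, y} * (f x * g x))
                    - (\<Sum>x\<in>F. \<Sum>y\<in>F. b x y * (g x * f y))"
    by (simp add: sum_subtractf)
  also have "(\<Sum>x\<in>F. \<Sum>y\<in>F. b x y * (g x * f y)) = (\<Sum>x\<in>F. \<Sum>y\<in>F. b x y * (f x * g y))"
    by (subst sum.swap, subst b_sym) (simp only: mult_ac)
  also have "(\<Sum>x\<in>F. \<Sum>y\<in>neighbours E x. c {x, y} * (f x * g x)) - \<dots>
      = (\<Sum>x\<in>F. (\<omega> x)\<^sup>2 * laplacian E \<omega> c g x * f x)"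
    unfolding weight_laplacian 1[symmetric]
    by (simp add: sum_distrib_right flip: sum_subtractf) (simp add: algebra_simps)
  also have "\<dots> = l2_inner V \<omega> f (laplacian E \<omega> c g)"
    using finF FV supp by (subst l2_inner_eq_sum[of F]) (auto simp: mult_ac)
  finally show ?thesis .
qed

section \<open>The resolvent\<close>

text \<open>The diagonal coefficient of \<open>\<Delta> + 1\<close> after multiplication by
  \<open>(\<omega> x)\<^sup>2\<close>.\<close>

definition deg :: "'v \<Rightarrow> real" where
  "deg x = (\<omega> x)\<^sup>2 + (\<Sum>y\<in>neighbours E x. c {x, y})"

text \<open>At a vertex of \<open>V\<close> this is one step of the random walk that jumps from
  \<open>x\<close> to \<open>y\<close> with probability \<open>c {x, y} / deg x\<close> and dies
  with the remaining probability \<open>(\<omega> x)\<^sup>2 / deg x\<close>.\<close>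

definition walk :: "('v \<Rightarrow> ennreal) \<Rightarrow> 'v \<Rightarrow> ennreal" where
  "walk f x = (\<Sum>y\<in>neighbours E x. ennreal (c {x, y} / deg x) * f y)"

text \<open>Multiplied by \<open>(\<omega> x)\<^sup>2 / deg x\<close>, the equation \<open>\<Delta> h + h = u\<close> at \<open>x\<close> reads \<open>h = source u + walk h\<close>
  for \<open>h, u \<ge> 0\<close>.\<close>

definition source :: "('v \<Rightarrow> ennreal) \<Rightarrow> 'v \<Rightarrow> ennreal" where
  "source u x = ennreal ((\<omega> x)\<^sup>2 / deg x) * u x"

text \<open>The Neumann series for \<open>h = source u + walk h\<close>. Started in
  \<open>V\<close>, it is the expected value of \<open>u\<close> at the vertex where the walk dies,
  counted as 0 if it never does. Values in \<open>ennreal\<close> make it defined for every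
  \<open>u\<close>.\<close>

definition resolvent :: "('v \<Rightarrow> ennreal) \<Rightarrow> 'v \<Rightarrow> ennreal" where
  "resolvent u x = (\<Sum>k. (walk ^^ k) (source u) x)"

section \<open>Elementary properties of the walk and its Neumann series\<close>

lemma deg_nonneg: "deg x \<ge> 0"
  unfolding deg_def by (intro add_nonneg_nonneg sum_nonneg) (auto dest: cond_neighbour_pos)

lemma deg_pos: "x \<in> V \<Longrightarrow> deg x > 0"
  unfolding deg_def
  by (intro add_pos_nonneg sum_nonneg) (auto dest: cond_neighbour_pos weight_pos)

lemma source_coeff_nonneg: "0 \<le> (\<omega> x)\<^sup>2 / deg x"
  by (simp add: deg_nonneg)

lemma walk_coeff_nonneg: "y \<in> neighbours E x \<Longrightarrow> 0 \<le> c {x, y} / deg x"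
  by (intro divide_nonneg_nonneg deg_nonneg less_imp_le[OF cond_neighbour_pos])

lemma walk_add: "walk (\<lambda>x. f x + g x) = (\<lambda>x. walk f x + walk g x)"
  by (simp add: walk_def fun_eq_iff distrib_left sum.distrib)

lemma walk_cmult: "walk (\<lambda>x. t * f x) = (\<lambda>x. t * walk f x)"
  by (simp add: walk_def fun_eq_iff sum_distrib_left mult_ac)

lemma walk_mono: "(\<And>x. f x \<le> g x) \<Longrightarrow> walk f x \<le> walk g x"
  unfolding walk_def by (intro sum_mono mult_left_mono) auto

lemma walk_suminf: "walk (\<lambda>x. \<Sum>k. f k x) x = (\<Sum>k. walk (f k) x)"
  unfolding walk_def by (subst suminf_sum) auto

lemma walk_pow_add: "(walk ^^ k) (\<lambda>x. f x + g x) = (\<lambda>x. (walk ^^ k) f x + (walk ^^ k) g x)"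
  by (induction k) (simp_all add: walk_add)

lemma walk_pow_cmult: "(walk ^^ k) (\<lambda>x. t * f x) = (\<lambda>x. t * (walk ^^ k) f x)"
  by (induction k) (simp_all add: walk_cmult)

lemma walk_pow_mono: "(\<And>x. f x \<le> g x) \<Longrightarrow> (walk ^^ k) f x \<le> (walk ^^ k) g x"
  by (induction k arbitrary: x) (simp_all add: walk_mono)

lemma resolvent_add: "resolvent (\<lambda>x. f x + g x) x = resolvent f x + resolvent g x"
proof -
  have "source (\<lambda>x. f x + g x) = (\<lambda>x. source f x + source g x)"
    by (simp add: source_def fun_eq_iff distrib_left)
  then show ?thesis by (simp add: resolvent_def walk_pow_add suminf_add)
qed

lemma resolvent_cmult: "resolvent (\<lambda>x. t * f x) x = t * resolvent f x"
proof -
  have "source (\<lambda>x. t * f x) = (\<lambda>x. t * source f x)"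
    by (simp add: source_def fun_eq_iff mult_ac)
  then show ?thesis by (simp add: resolvent_def walk_pow_cmult)
qed

lemma resolvent_mono: "(\<And>x. f x \<le> g x) \<Longrightarrow> resolvent f x \<le> resolvent g x"
  unfolding resolvent_def
  by (intro suminf_le summableI walk_pow_mono) (simp add: source_def mult_left_mono)

lemma resolvent_eq: "resolvent u x = source u x + walk (resolvent u) x"
proof -
  have "walk (resolvent u) x = (\<Sum>k. (walk ^^ Suc k) (source u) x)"
    unfolding resolvent_def[abs_def] walk_suminf by simp
  then show ?thesis
    unfolding resolvent_def
    using suminf_offset[of "\<lambda>k. (walk ^^ k) (source u) x" 1] by (simp add: summableI)
qed

text \<open>The partial sums stay at most 1: splitting off the first term, the sum of
  \<open>n + 1\<close> terms is the source of 1 plus \<open>walk\<close> of the sum of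
  \<open>n\<close> terms, and the coefficients of source and walk add up to
  \<open>deg x / deg x\<close>.\<close>

lemma resolvent_one_le: "resolvent (\<lambda>_. 1) x \<le> 1"
  unfolding resolvent_def
proof (rule suminf_le_const[OF summableI])
  fix n
  show "(\<Sum>k<n. (walk ^^ k) (source (\<lambda>_. 1)) x) \<le> 1"
  proof (induction n arbitrary: x)
    case (Suc n)
    have "(\<Sum>k<Suc n. (walk ^^ k) (source (\<lambda>_. 1)) x)
        = source (\<lambda>_. 1) x + (\<Sum>k<n. walk ((walk ^^ k) (source (\<lambda>_. 1))) x)"
      by (subst sum.lessThan_Suc_shift) simp
    also have "(\<Sum>k<n. walk ((walk ^^ k) (source (\<lambda>_. 1))) x)
        = walk (\<lambda>x. \<Sum>k<n. (walk ^^ k) (source (\<lambda>_. 1)) x) x"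
      unfolding walk_def by (subst sum.swap) (simp add: sum_distrib_left)
    also have "\<dots> \<le> walk (\<lambda>_. 1) x" by (intro walk_mono Suc)
    also have "walk (\<lambda>_. 1) x = ennreal (\<Sum>y\<in>neighbours E x. c {x, y} / deg x)"
      unfolding walk_def mult_1_right by (intro sum_ennreal walk_coeff_nonneg)
    also have "source (\<lambda>_. 1) x + \<dots>
        = ennreal ((\<omega> x)\<^sup>2 / deg x + (\<Sum>y\<in>neighbours E x. c {x, y} / deg x))"
      unfolding source_def mult_1_right using deg_nonneg[of x]
      by (intro ennreal_plus[symmetric] sum_nonneg walk_coeff_nonneg) auto
    also have "(\<omega> x)\<^sup>2 / deg x + (\<Sum>y\<in>neighbours E x. c {x, y} / deg x)
        = ((\<omega> x)\<^sup>2 + (\<Sum>y\<in>neighbours E x. c {x, y})) / deg x"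
      by (simp add: sum_divide_distrib add_divide_distrib)
    also have "\<dots> = deg x / deg x" by (simp add: deg_def)
    \<comment> \<open>Only \<open>\<le>\<close> in general: off \<open>V\<close> the weight, and
      with it \<open>deg x\<close>, may vanish, and then the quotient is 0.\<close>
    also have "ennreal (deg x / deg x) \<le> 1" by simp
    finally show ?case by (simp add: add_left_mono)
  qed simp
qed

section \<open>Symmetry of the walk and of the resolvent\<close>

lemma deg_walk:
  "ennreal (deg x) * walk f x =
     (\<integral>\<^sup>+y. (if y \<in> neighbours E x then ennreal (c {x, y}) else 0) * f y \<partial>count_space UNIV)"
proof -
  have "ennreal (deg x) * walk f x = (\<Sum>y\<in>neighbours E x. ennreal (c {x, y}) * f y)"
    unfolding walk_def sum_distrib_left
  proof (rule sum.cong)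
    fix y assume y: "y \<in> neighbours E x"
    then have "deg x > 0" using deg_pos neighboursD by blast
    moreover have "c {x, y} > 0" using y by (rule cond_neighbour_pos)
    ultimately show "ennreal (deg x) * (ennreal (c {x, y} / deg x) * f y) = ennreal (c {x, y}) * f y"
      by (simp add: mult.assoc[symmetric] ennreal_mult[symmetric])
  qed simp
  \<comment> \<open>The finite sum is written as an integral over the whole type, with a kernel
    extended by 0, so that integrals can be exchanged later.\<close>
  also have "\<dots> = (\<integral>\<^sup>+y. (if y \<in> neighbours E x then ennreal (c {x, y}) else 0) * f y
      \<partial>count_space UNIV)"
    by (subst nn_integral_count_space'[OF finite_neighbours[of x]]) auto
  finally show ?thesis .
qed

text \<open>Detailed balance: \<open>deg x\<close> times the jump coefficient from \<open>x\<close>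
  to \<open>y\<close> is \<open>c {x, y}\<close>, which is symmetric in \<open>x\<close> and
  \<open>y\<close>.\<close>

lemma walk_symmetric:
  "(\<integral>\<^sup>+x. ennreal (deg x) * walk f x * g x \<partial>count_space UNIV)
     = (\<integral>\<^sup>+x. ennreal (deg x) * f x * walk g x \<partial>count_space UNIV)"
proof -
  define b where "b x y = (if y \<in> neighbours E x then ennreal (c {x, y}) else 0)" for x y
  have b_sym: "b x y = b y x" for x y
    using neighboursD by (auto simp: b_def insert_commute)
  let ?M = "count_space (UNIV :: 'v set)"
  have "(\<integral>\<^sup>+x. ennreal (deg x) * walk f x * g x \<partial>?M) = (\<integral>\<^sup>+x. \<integral>\<^sup>+y. b x y * f y * g x \<partial>?M \<partial>?M)"
    unfolding deg_walk b_def by (simp add: nn_integral_multc)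
  \<comment> \<open>Tonelli: both iterated integrals equal the integral over pairs, for counting
    measure on any type.\<close>
  also have "\<dots> = (\<integral>\<^sup>+y. \<integral>\<^sup>+x. b x y * f y * g x \<partial>?M \<partial>?M)"
    using nn_integral_fst_count_space[of "\<lambda>(x, y). b x y * f y * g x"]
      nn_integral_snd_count_space[of "\<lambda>(x, y). b x y * f y * g x"] by (simp only: prod.case)
  also have "\<dots> = (\<integral>\<^sup>+y. \<integral>\<^sup>+x. f y * (b y x * g x) \<partial>?M \<partial>?M)"
    by (subst b_sym) (simp only: mult_ac)
  also have "\<dots> = (\<integral>\<^sup>+x. ennreal (deg x) * f x * walk g x \<partial>?M)"
  proof (rule nn_integral_cong)
    fix y
    show "(\<integral>\<^sup>+x. f y * (b y x * g x) \<partial>?M) = ennreal (deg y) * f y * walk g y"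
      using deg_walk[of y g] by (simp add: nn_integral_cmult b_def mult_ac)
  qed
  finally show ?thesis .
qed

lemma walk_pow_symmetric:
  "(\<integral>\<^sup>+x. ennreal (deg x) * (walk ^^ k) f x * g x \<partial>count_space UNIV)
     = (\<integral>\<^sup>+x. ennreal (deg x) * f x * (walk ^^ k) g x \<partial>count_space UNIV)"
proof (induction k arbitrary: f)
  case (Suc k)
  show ?case using Suc[of "walk f"] walk_symmetric[of f "(walk ^^ k) g"]
    by (simp add: funpow_swap1)
qed simp

text \<open>Exchanges the measure \<open>\<omega>\<^sup>2\<close> for \<open>deg\<close>, with
  respect to which the powers of \<open>walk\<close> are symmetric.\<close>

lemma weight_eq_deg_source: "ennreal ((\<omega> x)\<^sup>2) * u x = ennreal (deg x) * source u x"
proof -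
  have "(\<omega> x)\<^sup>2 = deg x * ((\<omega> x)\<^sup>2 / deg x)"
  proof (cases "x \<in> V")
    case True
    then show ?thesis using deg_pos by force
  next
    case False
    then show ?thesis by (simp add: deg_def neighbours_outside)
  qed
  then have "ennreal ((\<omega> x)\<^sup>2) = ennreal (deg x) * ennreal ((\<omega> x)\<^sup>2 / deg x)"
    using deg_nonneg[of x] by (simp add: ennreal_mult[symmetric])
  then show ?thesis by (simp add: source_def mult.assoc)
qed

text \<open>Exchanging the measure on the factor \<open>v\<close> turns the left side into the sum
  over \<open>k\<close> of the \<open>deg\<close>-pairings of \<open>(walk ^^ k) (source u)\<close>
  with \<open>source v\<close>, and every such term is symmetric in \<open>u\<close> and
  \<open>v\<close>.\<close>

lemma resolvent_symmetric:
  "(\<integral>\<^sup>+x. ennreal ((\<omega> x)\<^sup>2) * resolvent u x * v x \<partial>count_space UNIV)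
     = (\<integral>\<^sup>+x. ennreal ((\<omega> x)\<^sup>2) * u x * resolvent v x \<partial>count_space UNIV)"
proof -
  have *: "(\<integral>\<^sup>+x. ennreal ((\<omega> x)\<^sup>2) * resolvent u x * v x \<partial>count_space UNIV)
      = (\<Sum>k. \<integral>\<^sup>+x. ennreal (deg x) * (walk ^^ k) (source u) x * source v x \<partial>count_space UNIV)"
    for u v
  proof -
    have "ennreal ((\<omega> x)\<^sup>2) * resolvent u x * v x
        = (\<Sum>k. ennreal (deg x) * (walk ^^ k) (source u) x * source v x)" for x
    proof -
      have "ennreal ((\<omega> x)\<^sup>2) * resolvent u x * v x = ennreal (deg x) * resolvent u x * source v x"
        by (simp only: mult.assoc mult.left_commute[of _ "resolvent u x"] weight_eq_deg_source[of x v])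
      then show ?thesis by (simp add: resolvent_def)
    qed
    then show ?thesis by (subst nn_integral_suminf[symmetric]) (simp_all only: borel_measurable_count_space)
  qed
  have "(\<integral>\<^sup>+x. ennreal ((\<omega> x)\<^sup>2) * u x * resolvent v x \<partial>count_space UNIV)
      = (\<integral>\<^sup>+x. ennreal ((\<omega> x)\<^sup>2) * resolvent v x * u x \<partial>count_space UNIV)"
    by (simp only: mult_ac)
  also have "\<dots> = (\<Sum>k. \<integral>\<^sup>+x. ennreal (deg x) * (walk ^^ k) (source v) x * source u x \<partial>count_space UNIV)"
    by (rule * )
  also have "\<dots> = (\<Sum>k. \<integral>\<^sup>+x. ennreal (deg x) * source v x * (walk ^^ k) (source u) x \<partial>count_space UNIV)"
    by (simp only: walk_pow_symmetric)
  also have "\<dots> = (\<Sum>k. \<integral>\<^sup>+x. ennreal (deg x) * (walk ^^ k) (source u) x * source v x \<partial>count_space UNIV)"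
    by (simp only: mult_ac)
  finally show ?thesis by (simp only: * )
qed

section \<open>Contraction estimates\<close>

text \<open>Jensen's inequality for an averaging operator of total mass at most 1. Finiteness of the
  value allows cancelling \<open>t\<^sup>2\<close> at the end.\<close>

lemma resolvent_square_le:
  assumes fin: "resolvent u x < \<infinity>"
  shows "(resolvent u x)\<^sup>2 \<le> resolvent (\<lambda>y. (u y)\<^sup>2) x"
proof -
  obtain t where t: "t \<ge> 0" "resolvent u x = ennreal t"
    using fin by (cases "resolvent u x") auto
  \<comment> \<open>Cauchy--Schwarz without a kernel, linearizing the square at the value \<open>t\<close>.\<close>
  have amgm: "ennreal (2 * t) * u y \<le> (u y)\<^sup>2 + ennreal (t\<^sup>2) * 1" for y
  proof (cases "u y")
    case (real r)
    have "0 \<le> (r - t)\<^sup>2" by simp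
    then have "2 * t * r \<le> r\<^sup>2 + t\<^sup>2" by (simp add: power2_diff algebra_simps)
    then have "ennreal (2 * t * r) \<le> ennreal (r\<^sup>2 + t\<^sup>2)" by (rule ennreal_leI)
    moreover have "ennreal (2 * t * r) = ennreal (2 * t) * u y"
      unfolding real using real t by (intro ennreal_mult) auto
    moreover have "ennreal (r\<^sup>2 + t\<^sup>2) = (u y)\<^sup>2 + ennreal (t\<^sup>2) * 1"
      unfolding real using real by (subst ennreal_plus) (auto simp: ennreal_power)
    ultimately show ?thesis by simp
  qed (simp add: power2_eq_square)
  have "ennreal (2 * t\<^sup>2) = ennreal (2 * t) * resolvent u x"
    unfolding t power2_eq_square mult.assoc[symmetric] using t by (intro ennreal_mult) auto
  also have "\<dots> = resolvent (\<lambda>y. ennreal (2 * t) * u y) x" by (simp add: resolvent_cmult)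
  also have "\<dots> \<le> resolvent (\<lambda>y. (u y)\<^sup>2 + ennreal (t\<^sup>2) * 1) x"
    by (intro resolvent_mono amgm)
  also have "\<dots> = resolvent (\<lambda>y. (u y)\<^sup>2) x + ennreal (t\<^sup>2) * resolvent (\<lambda>_. 1) x"
    unfolding resolvent_add resolvent_cmult ..
  also have "\<dots> \<le> resolvent (\<lambda>y. (u y)\<^sup>2) x + ennreal (t\<^sup>2)"
    using mult_left_mono[OF resolvent_one_le, of "ennreal (t\<^sup>2)" x] by (simp add: add_left_mono)
  finally have "ennreal (2 * t\<^sup>2) \<le> resolvent (\<lambda>y. (u y)\<^sup>2) x + ennreal (t\<^sup>2)" .
  moreover have "ennreal (2 * t\<^sup>2) = ennreal (t\<^sup>2) + ennreal (t\<^sup>2)"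
    by (subst ennreal_plus[symmetric]) auto
  ultimately have "ennreal (t\<^sup>2) \<le> resolvent (\<lambda>y. (u y)\<^sup>2) x"
    by (simp add: ennreal_add_left_cancel_le add.commute)
  then show ?thesis using t by (simp add: ennreal_power)
qed

text \<open>By symmetry the resolvent is moved onto the constant 1, where it is at most 1. Applied
  to the square of \<open>u\<close> and combined with \<open>resolvent_square_le\<close>, this
  yields the contraction of \<open>l\<^sup>2\<close>.\<close>

lemma resolvent_contraction_L1:
  "(\<integral>\<^sup>+x. ennreal ((\<omega> x)\<^sup>2) * resolvent u x \<partial>count_space UNIV)
     \<le> (\<integral>\<^sup>+x. ennreal ((\<omega> x)\<^sup>2) * u x \<partial>count_space UNIV)"
proof -
  have "(\<integral>\<^sup>+x. ennreal ((\<omega> x)\<^sup>2) * resolvent u x * 1 \<partial>count_space UNIV)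
      = (\<integral>\<^sup>+x. ennreal ((\<omega> x)\<^sup>2) * u x * resolvent (\<lambda>_. 1) x \<partial>count_space UNIV)"
    by (rule resolvent_symmetric)
  also have "\<dots> \<le> (\<integral>\<^sup>+x. ennreal ((\<omega> x)\<^sup>2) * u x * 1 \<partial>count_space UNIV)"
    by (intro nn_integral_mono mult_left_mono resolvent_one_le) simp
  finally show ?thesis by simp
qed

section \<open>The resolvent on real-valued functions\<close>

text \<open>Meant for nonnegative \<open>f\<close>, since \<open>ennreal\<close> cuts negative
  values to 0. For such \<open>f\<close> in \<open>l2\<close> the value turns out finite, so
  \<open>enn2real\<close> loses nothing.\<close>

definition real_resolvent :: "('v \<Rightarrow> real) \<Rightarrow> 'v \<Rightarrow> real" where
  "real_resolvent f x = enn2real (resolvent (\<lambda>y. ennreal (f y)) x)"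

lemma real_resolvent_nonneg: "real_resolvent f x \<ge> 0"
  by (simp add: real_resolvent_def)

lemma resolvent_outside: "x \<notin> V \<Longrightarrow> resolvent u x = source u x"
  by (subst resolvent_eq) (simp add: walk_def neighbours_outside)

text \<open>Finiteness comes first, as the square estimate presupposes it: the contraction bound
  makes the resolvent of the square finite at each vertex of \<open>V\<close>, and
  \<open>u \<le> u\<^sup>2 + 1\<close> passes this on to \<open>u\<close>. The square estimate and
  the same bound then give membership in \<open>l2\<close>.\<close>

lemma
  assumes f: "f \<in> l2 V \<omega>" and nonneg: "\<And>x. f x \<ge> 0"
  shows ennreal_real_resolvent: "resolvent (\<lambda>y. ennreal (f y)) x = ennreal (real_resolvent f x)"
    and real_resolvent_l2: "real_resolvent f \<in> l2 V \<omega>"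
proof -
  let ?u = "\<lambda>y. ennreal (f y)"
  have "(\<integral>\<^sup>+x. ennreal ((\<omega> x)\<^sup>2) * resolvent (\<lambda>y. (?u y)\<^sup>2) x \<partial>count_space UNIV)
      \<le> (\<integral>\<^sup>+x. ennreal ((\<omega> x)\<^sup>2) * (?u x)\<^sup>2 \<partial>count_space UNIV)"
    by (rule resolvent_contraction_L1)
  also have "\<dots> = (\<integral>\<^sup>+x. ennreal ((\<omega> x)\<^sup>2 * (f x)\<^sup>2) \<partial>count_space UNIV)"
    using nonneg by (simp add: ennreal_mult ennreal_power)
  also have "\<dots> < \<infinity>" using f by (simp add: l2_iff_nn_integral)
  finally have I: "(\<integral>\<^sup>+x. ennreal ((\<omega> x)\<^sup>2) * resolvent (\<lambda>y. (?u y)\<^sup>2) x \<partial>count_space UNIV) < \<infinity>" .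
  have fin: "resolvent ?u x < \<infinity>" for x
  proof (cases "x \<in> V")
    case True
    have "ennreal ((\<omega> x)\<^sup>2) * resolvent (\<lambda>y. (?u y)\<^sup>2) x < \<infinity>"
      by (rule le_less_trans[OF nn_integral_ge_point I]) simp
    then have *: "resolvent (\<lambda>y. (?u y)\<^sup>2) x < \<infinity>"
      using weight_pos[OF True] by (auto simp: ennreal_mult_less_top)
    have le: "?u y \<le> (?u y)\<^sup>2 + 1" for y
    proof -
      have "f y \<le> (f y)\<^sup>2 + 1"
        using zero_le_power2[of "f y - 1/2"] by (simp add: power2_diff field_simps)
      then have "ennreal (f y) \<le> ennreal ((f y)\<^sup>2 + 1)" by (rule ennreal_leI)
      then show ?thesis using nonneg by (simp add: ennreal_power)
    qed
    have "resolvent ?u x \<le> resolvent (\<lambda>y. (?u y)\<^sup>2 + 1) x" by (intro resolvent_mono le)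
    also have "\<dots> = resolvent (\<lambda>y. (?u y)\<^sup>2) x + resolvent (\<lambda>_. 1) x" by (rule resolvent_add)
    also have "\<dots> < \<infinity>"
      using * resolvent_one_le[of x] by (auto simp: less_top[symmetric] top_unique)
    finally show ?thesis .
  next
    case False
    then show ?thesis by (simp add: resolvent_outside source_def ennreal_mult_less_top)
  qed
  then show eq: "resolvent ?u x = ennreal (real_resolvent f x)" for x
    by (simp add: real_resolvent_def)
  have "(\<integral>\<^sup>+x. ennreal ((\<omega> x)\<^sup>2 * (real_resolvent f x)\<^sup>2) \<partial>count_space UNIV)
      = (\<integral>\<^sup>+x. ennreal ((\<omega> x)\<^sup>2) * (resolvent ?u x)\<^sup>2 \<partial>count_space UNIV)"
    by (simp add: eq ennreal_mult ennreal_power real_resolvent_nonneg)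
  also have "\<dots> \<le> (\<integral>\<^sup>+x. ennreal ((\<omega> x)\<^sup>2) * resolvent (\<lambda>y. (?u y)\<^sup>2) x \<partial>count_space UNIV)"
    by (intro nn_integral_mono mult_left_mono resolvent_square_le fin) simp
  finally have "(\<integral>\<^sup>+x. ennreal ((\<omega> x)\<^sup>2 * (real_resolvent f x)\<^sup>2) \<partial>count_space UNIV) < \<infinity>"
    using I by (rule le_less_trans)
  moreover have "real_resolvent f x = 0" if "x \<notin> V" for x
    using that f by (simp add: real_resolvent_def resolvent_outside source_def l2_def)
  ultimately show "real_resolvent f \<in> l2 V \<omega>" by (simp add: l2_iff_nn_integral)
qed

text \<open>In \<open>V\<close> this is \<open>resolvent_eq\<close> read in the reals and multiplied
  by \<open>deg x\<close>. All summands are finite and nonnegative, which allows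
  \<open>ennreal\<close> to be stripped.\<close>

lemma real_resolvent_solves:
  assumes f: "f \<in> l2 V \<omega>" and nonneg: "\<And>x. f x \<ge> 0"
  shows "laplacian E \<omega> c (real_resolvent f) x + real_resolvent f x = f x"
proof (cases "x \<in> V")
  case True
  let ?r = "real_resolvent f"
  have "ennreal (?r x) = ennreal ((\<omega> x)\<^sup>2 / deg x) * ennreal (f x)
      + (\<Sum>y\<in>neighbours E x. ennreal (c {x, y} / deg x) * ennreal (?r y))"
    using resolvent_eq[of "\<lambda>y. ennreal (f y)" x]
    by (simp add: source_def walk_def ennreal_real_resolvent[OF f nonneg])
  also have "\<dots> = ennreal ((\<omega> x)\<^sup>2 / deg x * f x + (\<Sum>y\<in>neighbours E x. c {x, y} / deg x * ?r y))"
  proof -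
    have "(\<Sum>y\<in>neighbours E x. ennreal (c {x, y} / deg x) * ennreal (?r y))
        = (\<Sum>y\<in>neighbours E x. ennreal (c {x, y} / deg x * ?r y))"
      by (intro sum.cong refl ennreal_mult[symmetric] real_resolvent_nonneg walk_coeff_nonneg)
    also have "\<dots> = ennreal (\<Sum>y\<in>neighbours E x. c {x, y} / deg x * ?r y)"
      by (intro sum_ennreal mult_nonneg_nonneg real_resolvent_nonneg walk_coeff_nonneg)
    finally have "(\<Sum>y\<in>neighbours E x. ennreal (c {x, y} / deg x) * ennreal (?r y))
        = ennreal (\<Sum>y\<in>neighbours E x. c {x, y} / deg x * ?r y)" .
    moreover have "ennreal ((\<omega> x)\<^sup>2 / deg x) * ennreal (f x) = ennreal ((\<omega> x)\<^sup>2 / deg x * f x)"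
      by (intro ennreal_mult[symmetric] source_coeff_nonneg nonneg)
    moreover have "0 \<le> (\<omega> x)\<^sup>2 / deg x * f x" using nonneg deg_nonneg by simp
    moreover have "0 \<le> (\<Sum>y\<in>neighbours E x. c {x, y} / deg x * ?r y)"
      by (intro sum_nonneg mult_nonneg_nonneg real_resolvent_nonneg walk_coeff_nonneg)
    ultimately show ?thesis by (simp only: ennreal_plus)
  qed
  finally have "?r x = (\<omega> x)\<^sup>2 / deg x * f x + (\<Sum>y\<in>neighbours E x. c {x, y} / deg x * ?r y)"
    by (subst (asm) ennreal_inj)
      (intro add_nonneg_nonneg sum_nonneg mult_nonneg_nonneg nonneg source_coeff_nonneg
          real_resolvent_nonneg walk_coeff_nonneg | assumption)+
  also have "\<dots> = ((\<omega> x)\<^sup>2 * f x + (\<Sum>y\<in>neighbours E x. c {x, y} * ?r y)) / deg x"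
    by (simp add: add_divide_distrib sum_divide_distrib)
  finally have "deg x * ?r x = (\<omega> x)\<^sup>2 * f x + (\<Sum>y\<in>neighbours E x. c {x, y} * ?r y)"
    using deg_pos[OF True] by simp
  \<comment> \<open>Subtracting the neighbour sum from \<open>deg x * ?r x\<close> leaves
    \<open>(\<omega> x)\<^sup>2 * (\<Delta> ?r x + ?r x)\<close>.\<close>
  then have "(\<omega> x)\<^sup>2 * (laplacian E \<omega> c ?r x + ?r x) = (\<omega> x)\<^sup>2 * f x"
    unfolding distrib_left weight_laplacian
    by (simp add: deg_def right_diff_distrib distrib_right sum_subtractf sum_distrib_right)
  then show ?thesis using weight_pos[OF True] by simp
next
  case False
  then show ?thesis using f real_resolvent_l2[OF f nonneg] by (simp add: laplacian_outside l2_def)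
qed

lemma real_resolvent_symmetric:
  assumes f: "f \<in> l2 V \<omega>" "\<And>x. f x \<ge> 0" and g: "g \<in> l2 V \<omega>" "\<And>x. g x \<ge> 0"
  shows "l2_inner V \<omega> (real_resolvent f) g = l2_inner V \<omega> f (real_resolvent g)"
proof -
  have "ennreal (l2_inner V \<omega> (real_resolvent f) g)
      = (\<integral>\<^sup>+x. ennreal ((\<omega> x)\<^sup>2) * resolvent (\<lambda>y. ennreal (f y)) x * ennreal (g x) \<partial>count_space UNIV)"
    by (subst l2_inner_eq_nn_integral)
      (auto simp: ennreal_real_resolvent real_resolvent_l2 f g real_resolvent_nonneg ennreal_mult)
  also have "\<dots> = (\<integral>\<^sup>+x. ennreal ((\<omega> x)\<^sup>2) * ennreal (f x) * resolvent (\<lambda>y. ennreal (g y)) x \<partial>count_space UNIV)"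
    by (rule resolvent_symmetric)
  also have "\<dots> = ennreal (l2_inner V \<omega> f (real_resolvent g))"
    by (subst l2_inner_eq_nn_integral)
      (auto simp: ennreal_real_resolvent real_resolvent_l2 f g real_resolvent_nonneg ennreal_mult)
  finally show ?thesis
    by (subst (asm) ennreal_inj)
      (auto simp: l2_inner_def f g real_resolvent_nonneg intro!: infsum_nonneg)
qed

text \<open>The coefficients \<open>1\<close> and \<open>- 1\<close> are written out so that the rules about linear combinations
  match syntactically.\<close>

definition signed_resolvent :: "('v \<Rightarrow> real) \<Rightarrow> 'v \<Rightarrow> real" where
  "signed_resolvent f =
     (\<lambda>x. 1 * real_resolvent (\<lambda>y. max (f y) 0) x + (- 1) * real_resolvent (\<lambda>y. max (- f y) 0) x)"

lemma l2_pos_part: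
  assumes "f \<in> l2 V \<omega>"
  shows "(\<lambda>y. max (f y) 0) \<in> l2 V \<omega>" "(\<lambda>y. max (- f y) 0) \<in> l2 V \<omega>"
proof -
  have s: "(\<lambda>x. (\<omega> x)\<^sup>2 * \<bar>f x\<bar>\<^sup>2) summable_on V" using assms by (simp add: l2_def)
  have "(\<lambda>x. (\<omega> x)\<^sup>2 * \<bar>max (f x) 0\<bar>\<^sup>2) summable_on V" "(\<lambda>x. (\<omega> x)\<^sup>2 * \<bar>max (- f x) 0\<bar>\<^sup>2) summable_on V"
    by (rule summable_on_comparison_test[OF s]; auto intro!: mult_left_mono simp: max_def)+
  then show "(\<lambda>y. max (f y) 0) \<in> l2 V \<omega>" "(\<lambda>y. max (- f y) 0) \<in> l2 V \<omega>"
    using assms by (auto simp: l2_def)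
qed

lemma signed_resolvent_l2: "f \<in> l2 V \<omega> \<Longrightarrow> signed_resolvent f \<in> l2 V \<omega>"
  unfolding signed_resolvent_def by (intro l2_lincomb real_resolvent_l2 l2_pos_part) auto

lemma signed_resolvent_solves:
  assumes f: "f \<in> l2 V \<omega>"
  shows "laplacian E \<omega> c (signed_resolvent f) x + signed_resolvent f x = f x"
  using real_resolvent_solves[OF l2_pos_part(1)[OF f] max.cobounded2, of x]
    real_resolvent_solves[OF l2_pos_part(2)[OF f] max.cobounded2, of x]
  unfolding signed_resolvent_def laplacian_lincomb by linarith

lemma signed_resolvent_symmetric:
  assumes f: "f \<in> l2 V \<omega>" and g: "g \<in> l2 V \<omega>"
  shows "l2_inner V \<omega> (signed_resolvent f) g = l2_inner V \<omega> f (signed_resolvent g)"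
proof -
  define fp fn gp gn where defs: "fp = (\<lambda>y. max (f y) 0)" "fn = (\<lambda>y. max (- f y) 0)"
    "gp = (\<lambda>y. max (g y) 0)" "gn = (\<lambda>y. max (- g y) 0)"
  have l2: "fp \<in> l2 V \<omega>" "fn \<in> l2 V \<omega>" "gp \<in> l2 V \<omega>" "gn \<in> l2 V \<omega>"
    unfolding defs by (rule l2_pos_part f g)+
  have nonneg: "fp x \<ge> 0" "fn x \<ge> 0" "gp x \<ge> 0" "gn x \<ge> 0" for x
    by (simp_all add: defs)
  \<comment> \<open>The bound variable \<open>c\<close> is a function in \<open>l2\<close> here and
    shadows the conductance.\<close>
  have bilinear: "l2_inner V \<omega> (\<lambda>x. 1 * a x + (- 1) * b x) (\<lambda>x. 1 * c x + (- 1) * d x)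
      = l2_inner V \<omega> a c - l2_inner V \<omega> a d - l2_inner V \<omega> b c + l2_inner V \<omega> b d"
    if "a \<in> l2 V \<omega>" "b \<in> l2 V \<omega>" "c \<in> l2 V \<omega>" "d \<in> l2 V \<omega>" for a b c d
    using l2_inner_lincomb_left[OF that(1,2) l2_lincomb[OF that(3,4)], of 1 "-1" 1 "-1"]
      l2_inner_lincomb_right[OF that(3,4,1), of 1 "-1"]
      l2_inner_lincomb_right[OF that(3,4,2), of 1 "-1"] by simp
  have "f = (\<lambda>x. 1 * fp x + (- 1) * fn x)" "g = (\<lambda>x. 1 * gp x + (- 1) * gn x)"
    by (auto simp: defs max_def)
  moreover have "signed_resolvent f = (\<lambda>x. 1 * real_resolvent fp x + (- 1) * real_resolvent fn x)"
    "signed_resolvent g = (\<lambda>x. 1 * real_resolvent gp x + (- 1) * real_resolvent gn x)"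
    by (simp_all only: signed_resolvent_def defs)
  \<comment> \<open>Each side expands into four pairings of positive and negative parts, which agree
    one by one.\<close>
  ultimately show ?thesis
    using bilinear[of "real_resolvent fp" "real_resolvent fn" gp gn]
      bilinear[of fp fn "real_resolvent gp" "real_resolvent gn"]
      real_resolvent_symmetric[of fp gp] real_resolvent_symmetric[of fp gn]
      real_resolvent_symmetric[of fn gp] real_resolvent_symmetric[of fn gn]
    by (simp only: l2 nonneg real_resolvent_l2)
qed

end

section \<open>Self-adjointness\<close>

text \<open>The constant weight of the theorem enters through this bound, with \<open>s\<close> its
  value.\<close>

locale weighted_graph_bounded_below = weighted_graph +
  fixes s :: real
  assumes s_pos: "s > 0" and s_le: "x \<in> V \<Longrightarrow> s \<le> \<omega> x"
begin

section \<open>Uniqueness of solutions and symmetry on the maximal domain\<close>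

lemma l2_kernel_nonpos:
  assumes g: "g \<in> l2 V \<omega>" and eq: "\<And>x. laplacian E \<omega> c g x + g x = 0"
  shows "g x \<le> 0"
proof (rule ccontr)
  assume "\<not> g x \<le> 0"
  then have pos: "g x > 0" by simp
  \<comment> \<open>This set is finite and contains \<open>x\<close>, so a maximum over it exists.
    It is a global one, since outside the set \<open>g\<close> stays below
    \<open>g x\<close>.\<close>
  let ?M = "{y. g y \<ge> g x}"
  have fin: "finite ?M" using l2_finite_superlevel[OF g pos s_pos s_le] .
  have "Max (g ` ?M) \<in> g ` ?M" using fin by (intro Max_in) auto
  then obtain z where z: "g x \<le> g z" "g z = Max (g ` ?M)" by force
  have max: "g y \<le> g z" for y
  proof (cases "g x \<le> g y")
    case True
    then show ?thesis unfolding z(2) using fin by (intro Max_ge) auto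
  qed (use z in linarith)
  have "z \<in> V" using g z(1) pos by (force simp: l2_def)
  have "0 \<le> (\<omega> z)\<^sup>2 * laplacian E \<omega> c g z"
    unfolding weight_laplacian
    using max by (intro sum_nonneg mult_nonneg_nonneg less_imp_le[OF cond_neighbour_pos]) auto
  then have "0 \<le> laplacian E \<omega> c g z"
    using weight_pos[OF \<open>z \<in> V\<close>] by (simp add: zero_le_mult_iff)
  then show False using eq[of z] z(1) pos by linarith
qed

lemma l2_kernel_trivial:
  assumes g: "g \<in> l2 V \<omega>" and eq: "\<And>x. laplacian E \<omega> c g x + g x = 0"
  shows "g x = 0"
proof -
  \<comment> \<open>The one-sided bound is applied to \<open>- g\<close>, written as a linear
    combination to match the available rules.\<close>
  have "(\<lambda>x. (- 1) * g x + 0 * g x) x \<le> 0"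
    by (rule l2_kernel_nonpos[OF l2_lincomb[OF g g]])
      (unfold laplacian_lincomb, use eq in \<open>simp add: algebra_simps add_eq_0_iff\<close>)
  then show ?thesis using l2_kernel_nonpos[OF g eq, of x] by simp
qed

text \<open>Both sides solve the same equation, and their difference lies in
  \<open>l\<^sup>2\<close>, hence in the trivial kernel.\<close>

lemma eq_signed_resolvent:
  assumes g: "g \<in> l2 V \<omega>" and Lg: "laplacian E \<omega> c g \<in> l2 V \<omega>"
  shows "signed_resolvent (\<lambda>x. 1 * laplacian E \<omega> c g x + 1 * g x) = g"
proof
  fix x
  let ?u = "\<lambda>x. 1 * laplacian E \<omega> c g x + 1 * g x"
  have u: "?u \<in> l2 V \<omega>" by (rule l2_lincomb[OF Lg g])
  have "(\<lambda>x. 1 * signed_resolvent ?u x + (- 1) * g x) x = 0"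
  proof (rule l2_kernel_trivial[OF l2_lincomb[OF signed_resolvent_l2[OF u] g]])
    fix y
    show "laplacian E \<omega> c (\<lambda>x. 1 * signed_resolvent ?u x + (- 1) * g x) y
        + (1 * signed_resolvent ?u y + (- 1) * g y) = 0"
      unfolding laplacian_lincomb using signed_resolvent_solves[OF u, of y] by simp
  qed
  then show "signed_resolvent ?u x = g x" by simp
qed

text \<open>Green's formula does not apply, as neither function need have finite support. With
  \<open>R\<close> the signed resolvent, \<open>g = R ?u\<close> and \<open>h = R ?v\<close>, so
  symmetry of \<open>R\<close> equates the pairing of \<open>?u\<close> with \<open>h\<close> and
  that of \<open>g\<close> with \<open>?v\<close>; the pairing of \<open>g\<close> with
  \<open>h\<close> then cancels.\<close>

lemma laplacian_symmetric_l2: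
  assumes g: "g \<in> l2 V \<omega>" and Lg: "laplacian E \<omega> c g \<in> l2 V \<omega>"
    and h: "h \<in> l2 V \<omega>" and Lh: "laplacian E \<omega> c h \<in> l2 V \<omega>"
  shows "l2_inner V \<omega> (laplacian E \<omega> c g) h = l2_inner V \<omega> g (laplacian E \<omega> c h)"
proof -
  let ?u = "\<lambda>x. 1 * laplacian E \<omega> c g x + 1 * g x"
  let ?v = "\<lambda>x. 1 * laplacian E \<omega> c h x + 1 * h x"
  have "l2_inner V \<omega> ?u (signed_resolvent ?v) = l2_inner V \<omega> (signed_resolvent ?u) ?v"
    by (simp only: signed_resolvent_symmetric l2_lincomb g Lg h Lh)
  then have "l2_inner V \<omega> ?u h = l2_inner V \<omega> g ?v"
    by (simp only: eq_signed_resolvent g Lg h Lh)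
  then show ?thesis
    by (simp only: l2_inner_lincomb_left l2_inner_lincomb_right g Lg h Lh)
qed

section \<open>The maximal Laplacian as the unique self-adjoint extension\<close>

abbreviation "L \<equiv> laplacian_operator V E \<omega> c"

text \<open>A concrete form of the adjoint of \<open>L\<close>.\<close>

definition max_laplacian :: "'a operator" where
  "max_laplacian g = (if g \<in> l2 V \<omega> \<and> laplacian E \<omega> c g \<in> l2 V \<omega>
     then Some (laplacian E \<omega> c g) else None)"

lemma max_laplacian_eq_Some:
  "max_laplacian g = Some h \<longleftrightarrow> g \<in> l2 V \<omega> \<and> h \<in> l2 V \<omega> \<and> h = laplacian E \<omega> c g"
  by (auto simp: max_laplacian_def)

lemma dom_laplacian_operator: "dom L = fin_supp V"
  by (auto simp: laplacian_operator_def restrict_map_def split: if_splits)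

lemma laplacian_operator_apply: "f \<in> fin_supp V \<Longrightarrow> L f = Some (laplacian E \<omega> c f)"
  by (simp add: laplacian_operator_def)

lemma fin_supp_lincomb:
  assumes "f \<in> fin_supp V" "g \<in> fin_supp V"
  shows "(\<lambda>x. a * f x + b * g x) \<in> fin_supp V"
proof -
  have "finite {x. a * f x + b * g x \<noteq> 0}"
    by (rule finite_subset[of _ "{x. f x \<noteq> 0} \<union> {x. g x \<noteq> 0}"])
      (use assms in \<open>auto simp: fin_supp_def\<close>)
  then show ?thesis using assms by (simp add: fin_supp_def)
qed

lemma densely_defined_if_fin_supp: "fin_supp V \<subseteq> dom T \<Longrightarrow> densely_defined V \<omega> T"
  unfolding densely_defined_def using fin_supp_dense by blast

lemma symmetric_laplacian_operator: "symmetric_operator V \<omega> L"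
proof -
  have "ran L \<subseteq> l2 V \<omega>"
    using laplacian_fin_supp fin_supp_subset_l2
    by (fastforce simp: ran_def laplacian_operator_def restrict_map_def split: if_splits)
  moreover have "(\<lambda>x. 0) \<in> fin_supp V" by (simp add: fin_supp_def)
  ultimately have "linear_operator V \<omega> L"
    unfolding linear_operator_def dom_laplacian_operator
    using fin_supp_subset_l2
    by (auto simp: laplacian_operator_apply fin_supp_lincomb laplacian_lincomb)
  moreover have "densely_defined V \<omega> L"
    by (simp add: densely_defined_if_fin_supp dom_laplacian_operator)
  ultimately show ?thesis
    unfolding symmetric_operator_def dom_laplacian_operator
    by (simp add: laplacian_operator_apply green)
qed

text \<open>Point masses lie in the domain of \<open>T\<close>. Testing against them and applying
  Green's formula reads off \<open>h\<close> at every vertex, so the adjoint of any extension of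
  \<open>L\<close> acts as the Laplacian.\<close>

lemma adjoint_value_extension:
  assumes ext: "L \<subseteq>\<^sub>m T" and adj: "is_adjoint_value V \<omega> T g h"
  shows "h = laplacian E \<omega> c g"
proof
  fix x
  have gh: "g \<in> l2 V \<omega>" "h \<in> l2 V \<omega>" using adj by (auto simp: is_adjoint_value_def)
  show "h x = laplacian E \<omega> c g x"
  proof (cases "x \<in> V")
    case True
    let ?d = "\<lambda>y. if y = x then 1 else 0 :: real"
    have d: "?d \<in> fin_supp V" using True by (simp add: fin_supp_def)
    have "T ?d = Some (laplacian E \<omega> c ?d)"
      using ext d by (metis dom_laplacian_operator laplacian_operator_apply map_le_def)
    then have "l2_inner V \<omega> (laplacian E \<omega> c ?d) g = l2_inner V \<omega> ?d h"
      using adj unfolding is_adjoint_value_def by (metis domI option.sel)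
    then have "l2_inner V \<omega> ?d (laplacian E \<omega> c g) = l2_inner V \<omega> ?d h"
      by (simp add: green d)
    moreover have "l2_inner V \<omega> ?d k = (\<omega> x)\<^sup>2 * k x" for k
      using True by (subst l2_inner_eq_sum[of "{x}"]) auto
    ultimately show ?thesis using weight_pos[OF True] by simp
  next
    case False
    then show ?thesis using gh by (simp add: l2_def laplacian_outside)
  qed
qed

text \<open>An adjoint value is unique, being the Laplacian of \<open>g\<close>, so the definite
  description in \<open>adjoint_operator\<close> denotes it.\<close>

lemma adjoint_eq_Some_iff:
  assumes "L \<subseteq>\<^sub>m T"
  shows "adjoint_operator V \<omega> T g = Some h \<longleftrightarrow> is_adjoint_value V \<omega> T g h"
proof -
  have "(THE k. is_adjoint_value V \<omega> T g k) = h" if "is_adjoint_value V \<omega> T g h" for h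
    using that adjoint_value_extension[OF assms] by (metis the_equality)
  then show ?thesis unfolding adjoint_operator_def by auto
qed

lemma laplacian_operator_le_max: "L \<subseteq>\<^sub>m max_laplacian"
  unfolding map_le_def dom_laplacian_operator
  using fin_supp_subset_l2 laplacian_fin_supp
  by (fastforce simp: laplacian_operator_apply max_laplacian_def)

text \<open>Adjoint values are Laplacians, so \<open>max_laplacian\<close> extends its adjoint; the
  converse inclusion is symmetry on the maximal domain.\<close>

lemma self_adjoint_max_laplacian: "self_adjoint V \<omega> max_laplacian"
proof -
  have dom: "f \<in> dom max_laplacian \<longleftrightarrow> f \<in> l2 V \<omega> \<and> laplacian E \<omega> c f \<in> l2 V \<omega>" for f
    by (simp add: max_laplacian_def dom_def)
  have the: "f \<in> dom max_laplacian \<Longrightarrow> the (max_laplacian f) = laplacian E \<omega> c f" for f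
    by (simp add: dom) (simp add: max_laplacian_def)
  have fin: "fin_supp V \<subseteq> dom max_laplacian"
    using map_le_implies_dom_le[OF laplacian_operator_le_max] by (simp add: dom_laplacian_operator)
  moreover have "(\<lambda>x. 0) \<in> fin_supp V" by (simp add: fin_supp_def)
  moreover have "ran max_laplacian \<subseteq> l2 V \<omega>" "dom max_laplacian \<subseteq> l2 V \<omega>"
    by (auto simp: ran_def dom max_laplacian_eq_Some)
  ultimately have "linear_operator V \<omega> max_laplacian"
    unfolding linear_operator_def
    by (auto simp: the max_laplacian_eq_Some dom l2_lincomb laplacian_lincomb simp del: domIff)
  moreover have "adjoint_operator V \<omega> max_laplacian g = max_laplacian g" for g
  proof -
    have "adjoint_operator V \<omega> max_laplacian g = Some h \<longleftrightarrow> max_laplacian g = Some h" for h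
      unfolding adjoint_eq_Some_iff[OF laplacian_operator_le_max] max_laplacian_eq_Some
    proof
      assume "is_adjoint_value V \<omega> max_laplacian g h"
      then show "g \<in> l2 V \<omega> \<and> h \<in> l2 V \<omega> \<and> h = laplacian E \<omega> c g"
        using adjoint_value_extension[OF laplacian_operator_le_max] by (simp add: is_adjoint_value_def)
    next
      assume "g \<in> l2 V \<omega> \<and> h \<in> l2 V \<omega> \<and> h = laplacian E \<omega> c g"
      then show "is_adjoint_value V \<omega> max_laplacian g h"
        using laplacian_symmetric_l2[of _ g]
        by (auto simp: is_adjoint_value_def the max_laplacian_eq_Some)
    qed
    then show ?thesis by (metis not_Some_eq)
  qed
  ultimately show ?thesis
    unfolding self_adjoint_def using fin by (auto intro: densely_defined_if_fin_supp)
qed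

text \<open>Being its own adjoint and extending \<open>L\<close>, the operator \<open>S\<close> acts
  as the Laplacian, so \<open>max_laplacian\<close> extends it. Conversely, symmetry of
  \<open>max_laplacian\<close> gives each \<open>g\<close> in its domain an adjoint value for
  \<open>S\<close>, which puts \<open>g\<close> into the domain of \<open>S\<close>.\<close>

lemma self_adjoint_extension_unique:
  assumes S: "self_adjoint V \<omega> S" and ext: "L \<subseteq>\<^sub>m S"
  shows "S = max_laplacian"
proof
  fix g
  have adj: "S g = Some h \<longleftrightarrow> is_adjoint_value V \<omega> S g h" for g h
    using S adjoint_eq_Some_iff[OF ext] by (simp add: self_adjoint_def)
  have le: "max_laplacian g = Some h" if "S g = Some h" for g h
    using that adjoint_value_extension[OF ext] unfolding adj
    by (auto simp: max_laplacian_eq_Some is_adjoint_value_def)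
  have "S g = Some h \<longleftrightarrow> max_laplacian g = Some h" for h
  proof
    assume "max_laplacian g = Some h"
    then have gh: "g \<in> l2 V \<omega>" "h \<in> l2 V \<omega>" "h = laplacian E \<omega> c g"
      by (auto simp: max_laplacian_eq_Some)
    have "l2_inner V \<omega> (the (S f)) g = l2_inner V \<omega> f h" if f: "f \<in> dom S" for f
    proof -
      obtain k where "S f = Some k" using f by auto
      with le[OF this] show ?thesis
        using gh laplacian_symmetric_l2[of f g] by (auto simp: max_laplacian_eq_Some)
    qed
    then show "S g = Some h" using gh by (simp add: adj is_adjoint_value_def)
  qed (rule le)
  then show "S g = max_laplacian g" by (metis not_Some_eq)
qed

lemma essentially_self_adjoint_laplacian: "essentially_self_adjoint V \<omega> L"
  unfolding essentially_self_adjoint_def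
  using symmetric_laplacian_operator self_adjoint_max_laplacian laplacian_operator_le_max
    self_adjoint_extension_unique by blast

end

theorem theorem3p1:
  fixes V :: "'v set" and E :: "'v set set"
    and \<omega> :: "'v \<Rightarrow> real" and c :: "'v set \<Rightarrow> real"
  assumes "simple_graph V E"
    and "infinite V"
    and "connected_graph V E"
    and "locally_finite_graph V E"
    and "\<forall>x\<in>V. \<omega> x > 0"
    and "\<omega> constant_on V"
    and "\<forall>e\<in>E. c e > 0"
  shows "essentially_self_adjoint V \<omega> (laplacian_operator V E \<omega> c)"
proof -
  obtain s where s: "\<And>x. x \<in> V \<Longrightarrow> \<omega> x = s"
    using assms(6) by (auto simp: constant_on_def)
  \<comment> \<open>A vertex is needed to see that \<open>s\<close> is actually a value of the
    weight, hence positive.\<close>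
  obtain x where "x \<in> V" using assms(2) by (metis finite.emptyI ex_in_conv)
  then have "s > 0" using s assms(5) by auto
  then interpret weighted_graph_bounded_below V E \<omega> c s
    using assms s by unfold_locales auto
  show ?thesis by (rule essentially_self_adjoint_laplacian)
qed

end
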